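(* Let $p$ be a positive integer. For all $k>0$, $|a_k-a^*_k|\le p-1$.
   Context: $\mathbb{N}$ denotes the positive integers; $[x]$ denotes the integer part of $x$; $p\in\mathbb{N}$ is fixed. Let $$r=\frac{(2p-1)+\sqrt{4p^2+1}}{2p},\qquad s=r+\frac1p=\frac{(2p+1)+\sqrt{4p^2+1}}{2p}.$$ These are irrational with $\frac1r+\frac1s=1$, so (Beatty's theorem) there is a well-defined involution $\tau:\mathbb{N}\to\mathbb{N}$ with $\tau([nr])=[ns]$ for all $n\in\mathbb{N}$ and $\tau=\tau^{-1}$. Let $\pi:\mathbb{N}\to\mathbb{N}$ be the greedy permutation associated with the multiset of differences $\pm M_{1,p}$, where $M_{1,p}$ consists of $p$ copies of each positive integer. Explicitly, $\pi$ is the involution of $\mathbb{N}$ built recursively as follows: for $k=1,2,3,\dots$, let $x_k$ be the least positive integer not in $\{x_i,y_i: 1\le i<k\}$, put $y_k=x_k+\lceil k/p\rceil$, and set $\pi(x_k)=y_k$, $\pi(y_k)=x_k$. Let $(a_k)_{k\ge1}$ be the elements of $\{n\in\mathbb{N}:\pi(n)>n\}$ listed in increasing order, and let $(a^*_k)_{k\ge1}$ be the elements of $\{n\in\mathbb{N}:\tau(n)>n\}$ listed in increasing order. *)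

theory Defs
  imports Complex_Main "HOL-Library.Infinite_Set"
begin

text \<open>
  Positive integers are rendered as \<^typ>\<open>nat\<close> with explicit positivity guards.
  The values of the functions below at argument \<open>0\<close>, or for parameter \<open>p = 0\<close>, are irrelevant.
\<close>

definition beatty_r :: "nat \<Rightarrow> real" where
  "beatty_r p = ((2 * real p - 1) + sqrt (4 * (real p)\<^sup>2 + 1)) / (2 * real p)"

definition beatty_s :: "nat \<Rightarrow> real" where
  "beatty_s p = beatty_r p + 1 / real p"

definition beatty_A :: "nat \<Rightarrow> nat \<Rightarrow> nat" where
  "beatty_A p n = nat \<lfloor>real n * beatty_r p\<rfloor>"

definition beatty_B :: "nat \<Rightarrow> nat \<Rightarrow> nat" where
  "beatty_B p n = nat \<lfloor>real n * beatty_s p\<rfloor>"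

text \<open>
  By Beatty's theorem every positive \<open>m\<close> is equal to exactly one value among all
  \<^term>\<open>beatty_A p n\<close> and \<^term>\<open>beatty_B p n\<close> with \<open>n > 0\<close>, for exactly one \<open>n\<close>,
  so the description is proper for positive \<open>m\<close> and \<open>p\<close>.
\<close>

definition beatty_tau :: "nat \<Rightarrow> nat \<Rightarrow> nat" where
  "beatty_tau p m = (THE v. \<exists>n>0.
      (m = beatty_A p n \<and> v = beatty_B p n) \<or> (m = beatty_B p n \<and> v = beatty_A p n))"

text \<open>
  The \<open>k\<close>-th difference of the greedy construction for \<open>p\<close> copies of each positive integer.
\<close>

definition greedy_diff :: "nat \<Rightarrow> nat \<Rightarrow> nat" where
  "greedy_diff p k = nat \<lceil>real k / real p\<rceil>"

function greedy_x :: "nat \<Rightarrow> nat \<Rightarrow> nat" where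
  "greedy_x p k = (LEAST n. n > 0 \<and>
      n \<notin> (\<Union>i\<in>{1..<k}. {greedy_x p i, greedy_x p i + greedy_diff p i}))"
  by pat_completeness auto
termination by (relation "measure snd") auto

declare greedy_x.simps [simp del]

definition greedy_y :: "nat \<Rightarrow> nat \<Rightarrow> nat" where
  "greedy_y p k = greedy_x p k + greedy_diff p k"

text \<open>
  The pairs \<open>{greedy_x p k, greedy_y p k}\<close> with \<open>k > 0\<close> partition the positive integers
  when \<open>p > 0\<close>, so the description is proper there.
\<close>

definition greedy_pi :: "nat \<Rightarrow> nat \<Rightarrow> nat" where
  "greedy_pi p m = (THE v. \<exists>k>0.
      (m = greedy_x p k \<and> v = greedy_y p k) \<or> (m = greedy_y p k \<and> v = greedy_x p k))"

text \<open>
  \<^const>\<open>enumerate\<close> lists a set of naturals increasingly starting from index \<open>0\<close>,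
  whereas the sequences here start from index \<open>1\<close>.
\<close>

definition greedy_a :: "nat \<Rightarrow> nat \<Rightarrow> nat" where
  "greedy_a p k = enumerate {n. n > 0 \<and> greedy_pi p n > n} (k - 1)"

definition beatty_a :: "nat \<Rightarrow> nat \<Rightarrow> nat" where
  "beatty_a p k = enumerate {n. n > 0 \<and> beatty_tau p n > n} (k - 1)"

end

theory Submission
  imports Defs
begin

text \<open>
  Both permutations come from a splitting of the positive integers into two increasing
  sequences \<open>X\<close> and \<open>Y\<close> with \<open>X k < Y k\<close>, whose terms of equal index are interchanged.
  The points moved upwards are therefore exactly the values of \<open>X\<close>, so the theorem compares
  the greedy sequence \<open>x\<^sub>k\<close> with \<open>\<lfloor>k r\<rfloor>\<close>; on the Beatty side this uses Beatty's
  theorem (\<open>beatty_cover\<close>, \<open>beatty_disjoint\<close>).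

  The idea of the comparison is that the deviation \<open>e\<^sub>k = x\<^sub>k - k r\<close> reproduces itself. If
  \<open>y\<^sub>m < x\<^sub>k < y\<^bsub>m+1\<^esub>\<close>, then counting the integers up to \<open>x\<^sub>k\<close> gives \<open>x\<^sub>k = k + m\<close>
  (\<open>X_eq_index_plus_count\<close>), while \<open>y\<^sub>i = x\<^sub>i + \<lceil>i/p\<rceil>\<close> equals \<open>i s + e\<^sub>i\<close> up to an error
  in \<open>[0, 1 - 1/p]\<close>. Hence a bound on \<open>e\<^sub>m\<close> and \<open>e\<^bsub>m+1\<^esub>\<close> yields a bound on \<open>e\<^sub>k\<close>: the
  recursion is affine, with factor \<open>- 1/(s - 1) = - (r - 1)\<close> of absolute value below one.
  It maps the interval \<open>-p < e < (r - 1)(p - 1)\<close> into itself, and strong induction shows that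
  every \<open>e\<^sub>k\<close> lies there (\<open>greedy_x_bounds\<close>). Rounding \<open>k r\<close> down then turns this into the
  bound \<open>p - 1\<close> between integers.
\<close>

section \<open>Complementary sequences\<close>

lemma enumerate_range_strict_mono:
  fixes f :: "nat \<Rightarrow> nat"
  assumes "strict_mono f"
  shows "enumerate (range f) n = f n"
proof (induction n)
  case 0
  show ?case
    unfolding enumerate_0
    by (rule Least_equality)
      (use assms in \<open>auto simp: strict_mono_less_eq\<close>)
next
  case (Suc n)
  have "infinite (range f)"
    using assms by (simp add: range_inj_infinite strict_mono_imp_inj_on)
  then have "enumerate (range f) (Suc n) = (LEAST s. s \<in> range f \<and> f n < s)"
    using Suc enumerate_Suc'' by metis
  also have "\<dots> = f (Suc n)"
    by (rule Least_equality)
      (use assms in \<open>auto simp: strict_mono_less_eq strict_mono_less\<close>)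
  finally show ?case .
qed

text \<open>
  The index \<open>0\<close> is excluded throughout, so that sequences indexed by the positive integers
  can be functions on \<^typ>\<open>nat\<close> with an arbitrary value at \<open>0\<close>.
\<close>

locale complementary_pair =
  fixes X Y :: "nat \<Rightarrow> nat"
  assumes X_pos: "\<And>k. 0 < k \<Longrightarrow> 0 < X k"
    and X_less: "\<And>j k. 0 < j \<Longrightarrow> j < k \<Longrightarrow> X j < X k"
    and Y_less: "\<And>j k. 0 < j \<Longrightarrow> j < k \<Longrightarrow> Y j < Y k"
    and X_less_Y: "\<And>k. 0 < k \<Longrightarrow> X k < Y k"
    and disjoint: "\<And>j k. 0 < j \<Longrightarrow> 0 < k \<Longrightarrow> X j \<noteq> Y k"
    and cover: "\<And>n. 0 < n \<Longrightarrow> \<exists>k>0. n = X k \<or> n = Y k"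
begin

lemma X_eq_iff: "0 < j \<Longrightarrow> 0 < k \<Longrightarrow> X j = X k \<longleftrightarrow> j = k"
  by (metis X_less less_irrefl linorder_neqE_nat)

lemma Y_eq_iff: "0 < j \<Longrightarrow> 0 < k \<Longrightarrow> Y j = Y k \<longleftrightarrow> j = k"
  by (metis Y_less less_irrefl linorder_neqE_nat)

definition swap :: "nat \<Rightarrow> nat" where
  "swap m = (THE v. \<exists>k>0. (m = X k \<and> v = Y k) \<or> (m = Y k \<and> v = X k))"

lemma swap_X: "0 < k \<Longrightarrow> swap (X k) = Y k"
  unfolding swap_def by (rule the_equality) (auto simp: X_eq_iff disjoint)

lemma swap_Y: "0 < k \<Longrightarrow> swap (Y k) = X k"
  unfolding swap_def by (rule the_equality) (auto simp: Y_eq_iff disjoint[symmetric])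

lemma ascents_swap: "{n. n > 0 \<and> swap n > n} = range (\<lambda>i. X (Suc i))"
proof (intro set_eqI iffI)
  fix n assume "n \<in> {n. n > 0 \<and> swap n > n}"
  then have n: "0 < n" "n < swap n" by auto
  from cover[OF n(1)] obtain k where k: "0 < k" "n = X k \<or> n = Y k" by auto
  have "n \<noteq> Y k" using n(2) swap_Y[OF k(1)] X_less_Y[OF k(1)] by auto
  then have "n = X (Suc (k - 1))" using k by simp
  then show "n \<in> range (\<lambda>i. X (Suc i))" by blast
next
  fix n assume "n \<in> range (\<lambda>i. X (Suc i))"
  then show "n \<in> {n. n > 0 \<and> swap n > n}"
    by (auto simp: swap_X X_less_Y X_pos)
qed

lemma enumerate_ascents_swap:
  assumes "0 < k"
  shows "enumerate {n. n > 0 \<and> swap n > n} (k - 1) = X k"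
proof -
  have "strict_mono (\<lambda>i. X (Suc i))"
    by (rule strict_monoI) (simp add: X_less)
  then show ?thesis
    using assms by (simp add: ascents_swap enumerate_range_strict_mono)
qed

text \<open>
  The integers from \<open>1\<close> to \<open>X k\<close> are \<open>X 1, \<dots>, X k\<close> together with the terms of \<open>Y\<close>
  below \<open>X k\<close>, say \<open>Y 1, \<dots>, Y m\<close>. The condition on \<open>Y m\<close> is empty when \<open>m = 0\<close>.
\<close>

lemma X_eq_index_plus_count:
  assumes k: "0 < k"
  obtains m where "X k = k + m" "0 < m \<Longrightarrow> Y m < X k" "X k < Y (Suc m)" "m < k"
proof -
  define m where "m = (LEAST i. X k < Y (Suc i))"
  have ex: "X k < Y (Suc (k - 1))" using k X_less_Y by simp
  have above: "X k < Y (Suc m)" unfolding m_def by (rule LeastI, rule ex)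
  have "m \<le> k - 1" unfolding m_def by (rule Least_le, rule ex)
  then have "m < k" using k by simp
  have below: "Y i < X k" if "0 < i" "i \<le> m" for i
  proof -
    have "\<not> X k < Y (Suc (i - 1))"
      using that not_less_Least[of "i - 1" "\<lambda>i. X k < Y (Suc i)"] by (simp add: m_def)
    then show ?thesis using disjoint[OF k, of i] that by simp
  qed
  have "{1..X k} = X ` {1..k} \<union> Y ` {1..m}"
  proof (intro set_eqI iffI)
    fix n assume n: "n \<in> {1..X k}"
    then obtain j where j: "0 < j" "n = X j \<or> n = Y j" using cover[of n] by auto
    from j(2) show "n \<in> X ` {1..k} \<union> Y ` {1..m}"
    proof
      assume "n = X j"
      moreover have "j \<le> k" using n \<open>n = X j\<close> X_less[OF k, of j] by fastforce
      ultimately show ?thesis using j by auto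
    next
      assume "n = Y j"
      moreover have "j \<le> m"
      proof (rule ccontr)
        assume "\<not> j \<le> m"
        then have "Y (Suc m) \<le> Y j" using Y_less[of "Suc m" j] by (cases "j = Suc m") auto
        then show False using n above \<open>n = Y j\<close> by auto
      qed
      ultimately show ?thesis using j by auto
    qed
  next
    fix n assume "n \<in> X ` {1..k} \<union> Y ` {1..m}"
    then consider j where "0 < j" "j \<le> k" "n = X j" | j where "0 < j" "j \<le> m" "n = Y j"
      by (auto simp: Suc_le_eq)
    then show "n \<in> {1..X k}"
    proof cases
      case 1
      then show ?thesis using X_pos[of j] X_less[of j k] by (cases "j = k") auto
    next
      case 2
      then show ?thesis using below[of j] X_less_Y[of j] by auto
    qed
  qed
  then have "X k = card (X ` {1..k} \<union> Y ` {1..m})"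
    by (metis card_atLeastAtMost diff_Suc_1)
  also have "\<dots> = card (X ` {1..k}) + card (Y ` {1..m})"
  proof (rule card_Un_disjoint)
    show "X ` {1..k} \<inter> Y ` {1..m} = {}" using disjoint by auto
  qed simp_all
  also have "\<dots> = k + m"
  proof -
    have "inj_on X {1..k}" "inj_on Y {1..m}"
      by (auto simp: inj_on_def X_eq_iff Y_eq_iff)
    then show ?thesis by (simp add: card_image)
  qed
  finally show thesis using that above \<open>m < k\<close> below[of m] by auto
qed

end

section \<open>The greedy pairs\<close>

context
  fixes p :: nat
  assumes p: "0 < p"
begin

definition used :: "nat \<Rightarrow> nat set" where
  "used k = (\<Union>i\<in>{1..<k}. {greedy_x p i, greedy_y p i})"

lemma greedy_x_eq_Least: "greedy_x p k = (LEAST n. n > 0 \<and> n \<notin> used k)"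
  unfolding used_def greedy_y_def by (rule greedy_x.simps)

lemma greedy_x_new: "greedy_x p k > 0 \<and> greedy_x p k \<notin> used k"
proof -
  have "finite (used k \<union> {0})" by (simp add: used_def)
  then obtain n where "n \<notin> used k \<union> {0}" using ex_new_if_finite infinite_UNIV_nat by blast
  then have "n > 0 \<and> n \<notin> used k" by simp
  then show ?thesis unfolding greedy_x_eq_Least by (rule LeastI)
qed

lemma greedy_x_le: "n > 0 \<Longrightarrow> n \<notin> used k \<Longrightarrow> greedy_x p k \<le> n"
  unfolding greedy_x_eq_Least by (rule Least_le) simp

lemma used_mono: "j \<le> k \<Longrightarrow> used j \<subseteq> used k"
  unfolding used_def by force

lemma greedy_in_used:
  assumes "0 < j" "j < k"
  shows "greedy_x p j \<in> used k" "greedy_y p j \<in> used k"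
  using assms unfolding used_def by force+

lemma greedy_x_less: "greedy_x p j < greedy_x p k" if "0 < j" "j < k"
proof -
  have "greedy_x p k \<notin> used j" using greedy_x_new used_mono that by (meson less_imp_le subsetD)
  then have "greedy_x p j \<le> greedy_x p k" using greedy_x_le greedy_x_new by blast
  moreover have "greedy_x p j \<noteq> greedy_x p k" using greedy_in_used[OF that] greedy_x_new by metis
  ultimately show ?thesis by simp
qed

lemma greedy_diff_bounds:
  shows "real k / p \<le> real (greedy_diff p k)"
    and "real (greedy_diff p k) \<le> real k / p + 1 - 1 / p"
proof -
  define d where "d = \<lceil>real k / real p\<rceil>"
  have "d \<ge> 0" unfolding d_def by (simp add: le_ceiling_iff order_less_le_trans[of _ 0])
  then have gd: "real (greedy_diff p k) = of_int d" by (simp add: greedy_diff_def d_def)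
  show "real k / p \<le> real (greedy_diff p k)" unfolding gd d_def by simp
  have "of_int d < real k / p + 1" unfolding d_def by linarith
  then have "of_int d * real p < real k + real p" using p by (simp add: field_simps)
  then have "real_of_int (d * int p) < real_of_int (int k + int p)" by simp
  then have "d * int p + 1 \<le> int k + int p" by linarith
  then have "real_of_int (d * int p + 1) \<le> real_of_int (int k + int p)"
    by (simp only: of_int_le_iff)
  then have "of_int d \<le> (real k + real p - 1) / p" using p by (simp add: pos_le_divide_eq)
  then show "real (greedy_diff p k) \<le> real k / p + 1 - 1 / p"
    unfolding gd using p by (simp add: add_divide_distrib diff_divide_distrib)
qed

lemma greedy_diff_mono: "j \<le> k \<Longrightarrow> greedy_diff p j \<le> greedy_diff p k"
  unfolding greedy_diff_def by (intro nat_mono ceiling_mono divide_right_mono) auto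

lemma greedy_x_less_y: "0 < k \<Longrightarrow> greedy_x p k < greedy_y p k"
  using greedy_diff_bounds(1)[of k] p unfolding greedy_y_def
  by (metis divide_pos_pos less_add_same_cancel1 less_le_trans of_nat_0_less_iff)

lemma greedy_y_less: "0 < j \<Longrightarrow> j < k \<Longrightarrow> greedy_y p j < greedy_y p k"
  unfolding greedy_y_def using greedy_x_less greedy_diff_mono[of j k] by (simp add: add_less_le_mono)

lemma greedy_disjoint:
  assumes "0 < j" "0 < k"
  shows "greedy_x p j \<noteq> greedy_y p k"
proof (cases "k < j")
  case True
  then show ?thesis using greedy_in_used[of k j] greedy_x_new[of j] assms by auto
next
  case False
  then have "greedy_x p j \<le> greedy_x p k" using greedy_x_less[of j k] assms by (cases "j = k") auto
  then show ?thesis using greedy_x_less_y[of k] assms by simp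
qed

lemma greedy_x_ge: "0 < k \<Longrightarrow> k \<le> greedy_x p k"
proof (induction k rule: nat_induct_non_zero)
  case 1
  show ?case using greedy_x_new[of 1] by simp
next
  case (Suc k)
  then show ?case using greedy_x_less[of k "Suc k"] by simp
qed

text \<open>An integer that is never used would bound all the increasing \<open>x\<^sub>k\<close> from above.\<close>

lemma greedy_cover:
  assumes "0 < n"
  shows "\<exists>k>0. n = greedy_x p k \<or> n = greedy_y p k"
proof -
  have "\<not> greedy_x p (Suc n) \<le> n" using greedy_x_ge[of "Suc n"] by simp
  then have "n \<in> used (Suc n)" using greedy_x_le[OF assms] by blast
  then obtain i where "i \<in> {1..<Suc n}" "n = greedy_x p i \<or> n = greedy_y p i"
    unfolding used_def by blast
  then show ?thesis by (intro exI[of _ i]) simp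
qed

lemma greedy_complementary: "complementary_pair (greedy_x p) (greedy_y p)"
proof
  show "0 < greedy_x p k" for k using greedy_x_new by blast
qed (fact greedy_x_less greedy_y_less greedy_x_less_y greedy_disjoint greedy_cover)+

lemma greedy_a_eq: "0 < k \<Longrightarrow> greedy_a p k = greedy_x p k"
  using complementary_pair.enumerate_ascents_swap[OF greedy_complementary]
  unfolding greedy_a_def greedy_pi_def complementary_pair.swap_def[OF greedy_complementary] .

section \<open>The Beatty pair\<close>

text \<open>The number \<open>4p\<^sup>2 + 1\<close> lies strictly between the squares of \<open>2p\<close> and \<open>2p + 1\<close>.\<close>

lemma sqrt_discriminant_irrational: "sqrt (4 * (real p)\<^sup>2 + 1) \<notin> \<rat>"
proof
  assume "sqrt (4 * (real p)\<^sup>2 + 1) \<in> \<rat>"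
  then obtain a b :: nat where b: "b \<noteq> 0" "\<bar>sqrt (4 * (real p)\<^sup>2 + 1)\<bar> = real a / real b"
    and cop: "coprime a b"
    by (rule Rats_abs_nat_div_natE)
  have "(real a)\<^sup>2 / (real b)\<^sup>2 = 4 * (real p)\<^sup>2 + 1"
    unfolding power_divide[symmetric] b(2)[symmetric] by simp
  then have "(real a)\<^sup>2 = (4 * (real p)\<^sup>2 + 1) * (real b)\<^sup>2"
    using b by (simp add: field_simps)
  then have "real (a\<^sup>2) = real ((4 * p\<^sup>2 + 1) * b\<^sup>2)"
    by (simp add: distrib_right)
  then have eq: "a\<^sup>2 = (4 * p\<^sup>2 + 1) * b\<^sup>2" by (simp only: of_nat_eq_iff)
  then have "b\<^sup>2 dvd a\<^sup>2" by simp
  then have "b dvd a" by simp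
  then have "b = 1" using cop by (metis coprime_absorb_right nat_dvd_1_iff_1)
  then have "a\<^sup>2 = (2 * p)\<^sup>2 + 1" using eq by (simp add: power2_eq_square)
  moreover from this have "(2 * p)\<^sup>2 < a\<^sup>2" by simp
  then have "2 * p + 1 \<le> a" using power_less_imp_less_base by fastforce
  then have "(2 * p + 1)\<^sup>2 \<le> a\<^sup>2" by (rule power_mono) simp
  ultimately show False using p by (simp add: power2_eq_square)
qed

lemma r_irrational: "beatty_r p \<notin> \<rat>"
proof
  assume "beatty_r p \<in> \<rat>"
  then have "2 * real p * beatty_r p - (2 * real p - 1) \<in> \<rat>" by simp
  moreover have "2 * real p * beatty_r p - (2 * real p - 1) = sqrt (4 * (real p)\<^sup>2 + 1)"
    using p by (simp add: beatty_r_def field_simps)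
  ultimately show False using sqrt_discriminant_irrational by simp
qed

lemma s_irrational: "beatty_s p \<notin> \<rat>"
proof
  assume "beatty_s p \<in> \<rat>"
  then have "beatty_s p - 1 / real p \<in> \<rat>" by simp
  then show False using r_irrational by (simp add: beatty_s_def)
qed

lemma r_bounds: "1 < beatty_r p" "beatty_r p < 2"
proof -
  let ?q = "sqrt (4 * (real p)\<^sup>2 + 1)"
  have "1 < ?q" using p by simp
  then show "1 < beatty_r p" using p by (simp add: beatty_r_def field_simps)
  have "?q < 2 * real p + 1"
    by (rule real_less_lsqrt) (use p in \<open>auto simp: power2_eq_square algebra_simps\<close>)
  then show "beatty_r p < 2" using p by (simp add: beatty_r_def field_simps)
qed

lemma s_eq: "beatty_s p = beatty_r p + 1 / p"
  by (simp add: beatty_s_def)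

lemma r_minus_1_times_s_minus_1: "(beatty_r p - 1) * (beatty_s p - 1) = 1"
proof -
  define q where "q = sqrt (4 * (real p)\<^sup>2 + 1)"
  have "q * q = 4 * (real p)\<^sup>2 + 1" unfolding q_def by simp
  then have "(q - 1) * (q + 1) = (2 * real p) * (2 * real p)"
    by (simp add: algebra_simps power2_eq_square)
  moreover have "beatty_r p - 1 = (q - 1) / (2 * p)" "beatty_s p - 1 = (q + 1) / (2 * p)"
    using p by (simp_all add: beatty_s_def beatty_r_def q_def field_simps)
  ultimately show ?thesis using p by simp
qed

lemma inverse_r_plus_inverse_s: "1 / beatty_r p + 1 / beatty_s p = 1"
proof -
  have "0 < beatty_s p" using r_bounds p by (simp add: s_eq add_pos_pos)
  then show ?thesis using r_minus_1_times_s_minus_1 r_bounds by (simp add: field_simps)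
qed

lemma split_r_s: "x / beatty_r p + x / beatty_s p = x"
proof -
  have "x / beatty_r p + x / beatty_s p = x * (1 / beatty_r p + 1 / beatty_s p)"
    by (simp add: algebra_simps)
  then show ?thesis by (simp only: inverse_r_plus_inverse_s)
qed

end

lemma nat_mult_irrational_ne_nat:
  fixes t :: real
  assumes "t \<notin> \<rat>" "0 < j"
  shows "real j * t \<noteq> real m"
proof
  assume "real j * t = real m"
  then have "t = real m / real j" using assms by (simp add: field_simps)
  then show False using assms by simp
qed

lemma nat_floor_mult_irrational_eq_iff:
  fixes t :: real
  assumes "t \<notin> \<rat>" "0 < t" "0 < j"
  shows "nat \<lfloor>real j * t\<rfloor> = m \<longleftrightarrow> real m < real j * t \<and> real j * t < real m + 1"
proof -
  have "0 \<le> real j * t" using assms by simp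
  then have "nat \<lfloor>real j * t\<rfloor> = m \<longleftrightarrow> \<lfloor>real j * t\<rfloor> = int m" by (simp add: nat_eq_iff)
  also have "\<dots> \<longleftrightarrow> real m \<le> real j * t \<and> real j * t < real m + 1"
    by (simp add: floor_eq_iff)
  finally show ?thesis using nat_mult_irrational_ne_nat[OF assms(1,3), of m] by auto
qed

lemma nat_floor_mult_less:
  fixes t :: real
  assumes "1 < t" "j < k"
  shows "nat \<lfloor>real j * t\<rfloor> < nat \<lfloor>real k * t\<rfloor>"
proof -
  have "(real k - real j) * 1 \<le> (real k - real j) * t"
    using assms by (intro mult_left_mono) auto
  moreover have "1 \<le> real k - real j" using assms by linarith
  ultimately have "real j * t + 1 \<le> real k * t" by (simp add: algebra_simps)
  moreover have "0 \<le> real j * t" using assms by simp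
  ultimately show ?thesis by linarith
qed

text \<open>
  If no positive multiple of \<open>t\<close> has integer part \<open>m\<close>, then two consecutive multiples jump
  over the whole interval \<open>[m, m + 1]\<close>.
\<close>

lemma irrational_multiples_jump:
  fixes t :: real
  assumes t: "t \<notin> \<rat>" "1 < t" and m: "0 < m" and miss: "\<And>j. 0 < j \<Longrightarrow> nat \<lfloor>real j * t\<rfloor> \<noteq> m"
  obtains j :: nat where "real j < real m / t" "(real m + 1) / t < real j + 1"
proof -
  define j where "j = nat \<lfloor>real m / t\<rfloor>"
  have "0 \<le> real m / t" using t by simp
  then have j: "real j \<le> real m / t" "real m / t < real j + 1" unfolding j_def by linarith+
  have "real j * t \<noteq> real m"
    using nat_mult_irrational_ne_nat[OF t(1), of j m] m by (cases "j = 0") auto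
  then have "real j \<noteq> real m / t" using t by (auto simp: field_simps)
  moreover have "(real m + 1) / t < real j + 1"
  proof -
    have "real m < real (Suc j) * t" using j t by (simp add: field_simps)
    then have "real m + 1 \<le> real (Suc j) * t"
      using nat_floor_mult_irrational_eq_iff[of t "Suc j" m] t miss[of "Suc j"] by force
    moreover have "real (Suc j) * t \<noteq> real (m + 1)"
      by (rule nat_mult_irrational_ne_nat) (use t in auto)
    ultimately have "real m + 1 < real (Suc j) * t" by simp
    then show ?thesis using t by (simp add: field_simps)
  qed
  ultimately show thesis using that[of j] j(1) by simp
qed

context
  fixes p :: nat
  assumes p: "0 < p"
begin

lemma r_less_s: "beatty_r p < beatty_s p"
  using p by (simp add: s_eq)

text \<open>
  A common value \<open>m = \<lfloor>j r\<rfloor> = \<lfloor>k s\<rfloor>\<close> would put the integer \<open>j + k\<close> strictly between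
  \<open>m/r + m/s = m\<close> and \<open>m + 1\<close>.
\<close>

lemma beatty_disjoint:
  assumes "0 < j" "0 < k"
  shows "beatty_A p j \<noteq> beatty_B p k"
proof
  let ?r = "beatty_r p" and ?s = "beatty_s p"
  have pos: "0 < ?r" "0 < ?s" using r_bounds[OF p] r_less_s by auto
  define m where "m = beatty_A p j"
  assume "beatty_A p j = beatty_B p k"
  then have "beatty_B p k = m" by (simp add: m_def)
  then have "real m < j * ?r" "j * ?r < real m + 1" "real m < k * ?s" "k * ?s < real m + 1"
    using nat_floor_mult_irrational_eq_iff[OF r_irrational[OF p] pos(1) assms(1), of m]
      nat_floor_mult_irrational_eq_iff[OF s_irrational[OF p] pos(2) assms(2), of m]
    by (auto simp: m_def[symmetric] beatty_A_def[symmetric] beatty_B_def[symmetric])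
  then have "real m / ?r < j" "j < (real m + 1) / ?r" "real m / ?s < k" "k < (real m + 1) / ?s"
    using pos by (simp_all add: field_simps)
  then have "real m < real (j + k)" "real (j + k) < real (m + 1)"
    using split_r_s[OF p, of "real m"] split_r_s[OF p, of "real m + 1"] by auto
  then show False by (simp only: of_nat_less_iff)
qed

text \<open>
  If \<open>m\<close> is missed by both sequences, the two jumps over \<open>[m, m + 1]\<close> add up to
  \<open>i + j < m\<close> and \<open>m + 1 < i + j + 2\<close>, which no integers satisfy.
\<close>

lemma beatty_cover:
  assumes "0 < m"
  shows "\<exists>k>0. m = beatty_A p k \<or> m = beatty_B p k"
proof (rule ccontr)
  let ?r = "beatty_r p" and ?s = "beatty_s p"
  assume "\<not> ?thesis"
  then have miss: "nat \<lfloor>real j * ?r\<rfloor> \<noteq> m" "nat \<lfloor>real j * ?s\<rfloor> \<noteq> m" if "0 < j" for j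
    using that unfolding beatty_A_def beatty_B_def by blast+
  have gt: "1 < ?r" "1 < ?s" using r_bounds[OF p] r_less_s by auto
  obtain i :: nat where i: "real i < real m / ?r" "(real m + 1) / ?r < real i + 1"
    using irrational_multiples_jump[OF r_irrational[OF p] gt(1) assms miss(1)] by blast
  obtain j :: nat where j: "real j < real m / ?s" "(real m + 1) / ?s < real j + 1"
    using irrational_multiples_jump[OF s_irrational[OF p] gt(2) assms miss(2)] by blast
  have "real (i + j) < real m" "real (m + 1) < real (i + j + 2)"
    using i j split_r_s[OF p, of "real m"] split_r_s[OF p, of "real m + 1"] by auto
  then show False by (simp only: of_nat_less_iff)
qed

lemma beatty_complementary: "complementary_pair (beatty_A p) (beatty_B p)"
proof
  have gt: "1 < beatty_r p" "1 < beatty_s p" using r_bounds[OF p] r_less_s by auto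
  show A: "beatty_A p j < beatty_A p k" if "j < k" for j k
    unfolding beatty_A_def using nat_floor_mult_less gt that by blast
  show "beatty_B p j < beatty_B p k" if "j < k" for j k
    unfolding beatty_B_def using nat_floor_mult_less gt that by blast
  show "0 < beatty_A p k" if "0 < k" for k
    using A[OF that] by simp
  show "beatty_A p k < beatty_B p k" if "0 < k" for k
  proof -
    have "beatty_A p k \<le> beatty_B p k"
      unfolding beatty_A_def beatty_B_def using r_less_s
      by (intro nat_mono floor_mono mult_left_mono) auto
    then show ?thesis using beatty_disjoint[OF that that] by simp
  qed
qed (fact beatty_disjoint beatty_cover)+

lemma beatty_a_eq: "0 < k \<Longrightarrow> beatty_a p k = beatty_A p k"
  using complementary_pair.enumerate_ascents_swap[OF beatty_complementary]
  unfolding beatty_a_def beatty_tau_def complementary_pair.swap_def[OF beatty_complementary] .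

section \<open>Comparison\<close>

text \<open>
  With \<open>c = r - 1\<close>, the recursion turns a lower bound \<open>L\<close> for \<open>x\<^sub>k - k r\<close> into the upper
  bound \<open>- c (1 + L)\<close>, and an upper bound \<open>U\<close> into the lower bound \<open>- 1 - c (U + 1 - 1/p)\<close>.
  The interval below is the one whose ends are mapped onto each other: \<open>L = - p\<close> gives
  \<open>U = c (p - 1)\<close> at once, and \<open>U\<close> gives back \<open>L\<close> because \<open>(r - 1)(s - 1) = 1\<close> and
  \<open>s = r + 1/p\<close> amount to \<open>c\<^sup>2 + c/p = 1\<close>.
\<close>

lemma greedy_x_bounds:
  assumes "0 < k"
  shows "real k * beatty_r p - real p < real (greedy_x p k)
    \<and> real (greedy_x p k) < real k * beatty_r p + (beatty_r p - 1) * (real p - 1)"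
  using assms
proof (induction k rule: less_induct)
  case (less k)
  define c where "c = beatty_r p - 1"
  define u where "u = beatty_s p - 1"
  have c: "0 < c" "c < 1" using r_bounds[OF p] by (simp_all add: c_def)
  have cu: "c * u = 1" unfolding c_def u_def by (rule r_minus_1_times_s_minus_1[OF p])
  have u: "u = c + 1 / p" by (simp add: c_def u_def s_eq[OF p])
  obtain m where m: "greedy_x p k = k + m" "m < k"
    and below: "0 < m \<Longrightarrow> greedy_y p m < greedy_x p k"
    and above: "greedy_x p k < greedy_y p (Suc m)"
    using complementary_pair.X_eq_index_plus_count[OF greedy_complementary[OF p] less.prems]
    by metis
  have "real m < c * real k + c * (real p - 1)"
  proof (cases "m = 0")
    case True
    have "0 < c * real k" "0 \<le> c * (real p - 1)" using c p less.prems by simp_all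
    then show ?thesis using True by simp
  next
    case False
    then have "real m * beatty_r p - real p < real (greedy_x p m)"
      using less.IH[of m] m by simp
    moreover have "real (greedy_x p m) + real m / p + 1 \<le> real k + real m"
      using below False m(1) greedy_diff_bounds(1)[OF p, of m] by (simp add: greedy_y_def)
    ultimately have "real m * u < real k + real p - 1"
      by (simp add: u c_def algebra_simps)
    then have "c * (real m * u) < c * (real k + real p - 1)"
      using c by (intro mult_strict_left_mono) auto
    moreover have "c * (real m * u) = real m" using cu by (simp add: ac_simps)
    ultimately have "real m < c * (real k + real p - 1)" by (simp only:)
    then show ?thesis by (simp add: algebra_simps)
  qed
  then have upper: "real (greedy_x p k)
      < real k * beatty_r p + (beatty_r p - 1) * (real p - 1)"
    by (simp add: m(1) c_def algebra_simps)
  have "c * real k - real p < real m"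
  proof (cases "Suc m = k")
    \<comment> \<open>Here the bound at index \<open>m + 1\<close> is not yet available, but \<open>x\<^sub>k = 2k - 1\<close> is explicit.\<close>
    case True
    have "c * real k < 1 * real k" using c less.prems by (intro mult_strict_right_mono) auto
    also have "\<dots> = real m + 1" unfolding True[symmetric] by simp
    finally show ?thesis using p by linarith
  next
    case False
    then have "real (greedy_x p (Suc m)) < real (Suc m) * beatty_r p + c * (real p - 1)"
      using less.IH[of "Suc m"] m by (simp add: c_def)
    moreover have "real k + real m + 1
        \<le> real (greedy_x p (Suc m)) + (real (Suc m) / p + 1 - 1 / p)"
      using above m(1) greedy_diff_bounds(2)[OF p, of "Suc m"] by (simp add: greedy_y_def)
    ultimately have "real k - c * (real p - 1) - (1 - 1 / p) < real (Suc m) * u"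
      by (simp add: u c_def algebra_simps add_divide_distrib)
    moreover have "1 - 1 / real p = (real p - 1) / p" using p by (simp add: field_simps)
    ultimately have "real k - (real p - 1) * u < real (Suc m) * u"
      by (simp add: u algebra_simps)
    then have "c * (real k - (real p - 1) * u) < c * (real (Suc m) * u)"
      using c by (intro mult_strict_left_mono) auto
    moreover have "c * (real k - (real p - 1) * u) = c * real k - (real p - 1) * (c * u)"
      "c * (real (Suc m) * u) = real (Suc m) * (c * u)"
      by (simp_all add: algebra_simps)
    ultimately have "c * real k - (real p - 1) * (c * u) < real (Suc m) * (c * u)"
      by (simp only:)
    then show ?thesis by (simp add: cu)
  qed
  then have "real k * beatty_r p - real p < real (greedy_x p k)"
    by (simp add: m(1) c_def algebra_simps)
  with upper show ?case by blast
qed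

end

theorem mainTheorem5:
  fixes p k :: nat
  assumes "p > 0" and "k > 0"
  shows "\<bar>int (greedy_a p k) - int (beatty_a p k)\<bar> \<le> int p - 1"
proof -
  define t where "t = real k * beatty_r p"
  have "0 \<le> t" using r_bounds[OF assms(1)] by (simp add: t_def)
  then have A: "int (beatty_a p k) = \<lfloor>t\<rfloor>"
    by (simp add: beatty_a_eq[OF assms] beatty_A_def t_def)
  have "(beatty_r p - 1) * (real p - 1) \<le> 1 * (real p - 1)"
    using r_bounds[OF assms(1)] assms(1) by (intro mult_right_mono) auto
  then have "t - real p < real_of_int (int (greedy_a p k))"
    "real_of_int (int (greedy_a p k)) < t + real p - 1"
    using greedy_x_bounds[OF assms] by (simp_all add: greedy_a_eq[OF assms] t_def)
  \<comment> \<open>Both estimates are strict, so rounding \<open>t\<close> down costs nothing on the left and less than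
    one on the right.\<close>
  then show ?thesis unfolding A by linarith
qed

end
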